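(* Let $n \ge 1$ and let $i = \frac{3^n+1}{2} + \frac{3^j-1}{2} + \frac{3^k-1}{2}$, where $0 \le j \le k \le n-1$ are integers. Then $$(-1)^{i - \frac{3^n+1}{2}} \binom{3i - \frac{3^n-1}{2}}{i - \frac{3^n+1}{2}} \equiv \begin{cases} 1 \pmod 3 & \text{if } j = k, \\ (-1)^{j+k+1} \pmod 3 & \text{if } j < k. \end{cases}$$ *)

theory Defs
  imports Complex_Main "HOL-Number_Theory.Cong"
begin

end

theory Submission
  imports Defs
begin

text \<open>The number \<open>R k = (3 ^ k - 1) div 2\<close> has \<open>k\<close> base-3 digits, all equal to 1, and
  the binomial coefficient of the theorem is \<open>3 ^ n + R (j + 1) + R (k + 1)\<close> choose
  \<open>R j + R k\<close>. Lucas' congruence evaluates it digit by digit: all digit pairs contribute 1,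
  except the pair (2, 1) at position \<open>j\<close>, which occurs precisely when \<open>j < k\<close> and
  contributes -1. Finally \<open>R k\<close> has the parity of \<open>k\<close>.\<close>

text \<open>Vandermonde's sum for \<open>n + p\<close> collapses: \<open>p\<close> divides
  \<open>p choose i\<close> for 0 < i < p, so only the terms \<open>i = 0\<close> and
  \<open>i = p\<close> survive, as in (1 + X)^p \<equiv> 1 + X^p.\<close>

lemma choose_add_prime_cong:
  fixes p :: nat
  assumes "prime p"
  shows "[(n + p) choose r = (n choose r) + (if p \<le> r then n choose (r - p) else 0)] (mod p)"
proof -
  have p: "p > 0"
    using assms prime_gt_0_nat by blast
  have "(n + p) choose r = (\<Sum>i\<le>r. (p choose i) * (n choose (r - i)))"
    using vandermonde[of p n r] by (simp add: add.commute)
  also have "[\<dots> = (\<Sum>i\<le>r. (if i = 0 then n choose r else 0)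
      + (if i = p then n choose (r - p) else 0))] (mod p)"
  proof (rule cong_sum)
    fix i
    consider "i = 0" | "i = p" | "0 < i" "i < p" | "p < i" by linarith
    then show "[(p choose i) * (n choose (r - i)) = (if i = 0 then n choose r else 0)
      + (if i = p then n choose (r - p) else 0)] (mod p)"
    proof cases
      case 3
      then have "p dvd p choose i"
        using assms by (intro dvd_choose_prime) auto
      then show ?thesis
        using 3 by (simp add: cong_0_iff)
    qed (use p in \<open>simp_all add: binomial_eq_0\<close>)
  qed
  finally show ?thesis
    by (simp add: sum.distrib)
qed

text \<open>One step of Lucas' theorem, splitting off the last base-\<open>p\<close> digits. Raising
  \<open>a\<close> by one adds \<open>p\<close> to the upper entry, so the previous lemma plays the
  role of Pascal's rule for \<open>a choose c\<close>.\<close>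

lemma lucas_cong:
  fixes p :: nat
  assumes "prime p" and "b < p" and "d < p"
  shows "[(p * a + b) choose (p * c + d) = (a choose c) * (b choose d)] (mod p)"
proof (induction a arbitrary: c)
  case 0
  show ?case
    using assms by (cases c) (simp_all add: binomial_eq_0)
next
  case (Suc a)
  have *: "[(p * Suc a + b) choose (p * c + d) = ((p * a + b) choose (p * c + d))
      + (if p \<le> p * c + d then (p * a + b) choose (p * c + d - p) else 0)] (mod p)"
    using choose_add_prime_cong[OF assms(1), of "p * a + b" "p * c + d"] by (simp add: add_ac)
  show ?case
  proof (cases c)
    \<comment> \<open>Here the lower entry is \<open>d < p\<close>, so the shifted term is
      absent.\<close>
    case 0
    then show ?thesis
      using * Suc.IH[of 0] assms(3) by (auto intro: cong_trans)
  next
    case (Suc c')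
    note *
    also have "[((p * a + b) choose (p * c + d))
        + (if p \<le> p * c + d then (p * a + b) choose (p * c + d - p) else 0)
        = (a choose c) * (b choose d) + (a choose c') * (b choose d)] (mod p)"
      using Suc.IH[of c] Suc.IH[of c'] \<open>c = Suc c'\<close> by (intro cong_add) simp_all
    finally show ?thesis
      using \<open>c = Suc c'\<close> by (simp add: algebra_simps)
  qed
qed

text \<open>The recursion appends a last digit 1, which gives the shape \<open>3 * c + d\<close>
  that \<open>lucas_cong\<close> takes apart.\<close>

primrec repunit :: "nat \<Rightarrow> nat" where
  "repunit 0 = 0"
| "repunit (Suc k) = 3 * repunit k + 1"

lemma power3_eq_repunit: "3 ^ k = 2 * repunit k + 1"
  by (induction k) simp_all

lemma repunit_eq: "(3 ^ k - 1) div 2 = repunit k"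
  by (simp add: power3_eq_repunit)

lemma even_repunit_iff: "even (repunit k) \<longleftrightarrow> even k"
  by (induction k) simp_all

text \<open>Removing a last digit pair (1, 1) lowers both \<open>k\<close> and \<open>n\<close> by
  one. This is what remains of the full coefficient above position \<open>j\<close> when
  \<open>j < k\<close>.\<close>

lemma choose_repunit_cong:
  "k \<le> n \<Longrightarrow> [(3 ^ n + repunit (Suc k)) choose repunit k = 1] (mod 3)"
proof (induction k arbitrary: n)
  case (Suc k)
  then obtain n' where n: "n = Suc n'" "k \<le> n'"
    by (cases n) auto
  have "[(3 * (3 ^ n' + repunit (Suc k)) + 1) choose (3 * repunit k + 1)
      = ((3 ^ n' + repunit (Suc k)) choose repunit k) * (1 choose 1)] (mod 3)"
    by (rule lucas_cong) simp_all
  also have "[((3 ^ n' + repunit (Suc k)) choose repunit k) * (1 choose 1) = 1] (mod 3)"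
    using Suc.IH[OF n(2)] by simp
  finally show ?case
    using n(1) by (simp add: algebra_simps)
qed simp

text \<open>Induction on \<open>j\<close> removes pairs (2, 2). At \<open>j = 0\<close> either
  \<open>k = 0\<close> and the lower entry is 0, or the last pair is (2, 1) and gives the factor
  2.\<close>

lemma choose_sum_repunit_cong:
  assumes "j \<le> k" and "k < n"
  shows "[(3 ^ n + repunit (Suc j) + repunit (Suc k)) choose (repunit j + repunit k)
    = (if j = k then 1 else 2)] (mod 3)"
  using assms
proof (induction j arbitrary: k n)
  case 0
  show ?case
  proof (cases k)
    case (Suc k')
    then obtain n' where n: "n = Suc n'" "k' \<le> n'"
      using \<open>k < n\<close> by (cases n) auto
    have "[(3 * (3 ^ n' + repunit (Suc k')) + 2) choose (3 * repunit k' + 1)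
        = ((3 ^ n' + repunit (Suc k')) choose repunit k') * (2 choose 1)] (mod 3)"
      by (rule lucas_cong) simp_all
    also have "[((3 ^ n' + repunit (Suc k')) choose repunit k') * (2 choose 1)
        = 1 * (2 choose 1)] (mod 3)"
      by (rule cong_scalar_right) (rule choose_repunit_cong[OF n(2)])
    finally show ?thesis
      using n(1) \<open>k = Suc k'\<close> by (simp add: algebra_simps numeral_2_eq_2)
  qed simp
next
  case (Suc j)
  then obtain k' n' where kn: "k = Suc k'" "n = Suc n'" "j \<le> k'" "k' < n'"
    by (cases k; cases n) auto
  have "[(3 * (3 ^ n' + repunit (Suc j) + repunit (Suc k')) + 2)
        choose (3 * (repunit j + repunit k') + 2)
      = ((3 ^ n' + repunit (Suc j) + repunit (Suc k')) choose (repunit j + repunit k'))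
        * (2 choose 2)] (mod 3)"
    by (rule lucas_cong) simp_all
  also have "[((3 ^ n' + repunit (Suc j) + repunit (Suc k')) choose (repunit j + repunit k'))
      * (2 choose 2) = (if j = k' then 1 else 2)] (mod 3)"
    using Suc.IH[OF kn(3,4)] by simp
  finally show ?case
    using kn by (simp add: algebra_simps)
qed

theorem theorem6:
  fixes n i j k :: nat
  assumes "n \<ge> 1"
    and "j \<le> k" and "k \<le> n - 1"
    and "i = (3 ^ n + 1) div 2 + (3 ^ j - 1) div 2 + (3 ^ k - 1) div 2"
  shows "[(- 1) ^ (i - (3 ^ n + 1) div 2) *
            int ((3 * i - (3 ^ n - 1) div 2) choose (i - (3 ^ n + 1) div 2))
          = (if j = k then 1 else (- 1) ^ (j + k + 1))] (mod 3)"
proof -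
  have i: "i = repunit n + 1 + repunit j + repunit k"
    using assms(4) unfolding repunit_eq by (simp add: power3_eq_repunit)
  have bottom: "i - (3 ^ n + 1) div 2 = repunit j + repunit k"
    using i by (simp add: power3_eq_repunit)
  \<comment> \<open>With \<open>3 ^ n = 2 * repunit n + 1\<close>, the summand 3 left over from
    \<open>3 * i\<close> supplies the final 1 of \<open>3 ^ n\<close>,
    \<open>repunit (Suc j)\<close> and \<open>repunit (Suc k)\<close>.\<close>
  have top: "3 * i - (3 ^ n - 1) div 2 = 3 ^ n + repunit (Suc j) + repunit (Suc k)"
    unfolding repunit_eq i by (simp add: power3_eq_repunit)
  have sign: "(- 1 :: int) ^ (repunit j + repunit k) = (- 1) ^ (j + k)"
    by (simp add: uminus_power_if even_repunit_iff)
  have "[int ((3 ^ n + repunit (Suc j) + repunit (Suc k)) choose (repunit j + repunit k))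
      = int (if j = k then 1 else 2)] (mod int 3)"
    using choose_sum_repunit_cong[of j k n] assms(1-3) by (subst cong_int_iff) linarith
  also have "[int (if j = k then 1 else 2) = (if j = k then 1 else - 1)] (mod int 3)"
    by (simp add: cong_def)
  finally have "[(- 1) ^ (j + k) *
      int ((3 ^ n + repunit (Suc j) + repunit (Suc k)) choose (repunit j + repunit k))
      = (- 1) ^ (j + k) * (if j = k then 1 else - 1)] (mod 3)"
    by (intro cong_scalar_left) simp
  \<comment> \<open>For \<open>j = k\<close> the exponent \<open>j + k\<close> is even; otherwise
    the factor -1 raises it to \<open>j + k + 1\<close>.\<close>
  then show ?thesis
    unfolding bottom top sign by (simp split: if_splits)
qed

end
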